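(* Let $P$ be a school choice problem with student set $I$ and school set $S$, and let $I = Y \cup Z$ with $Y \cap Z = \emptyset$ and $Y, Z \neq \emptyset$, where $Y$ is the set of advantaged students and $Z$ the set of marginalized students, such that at every school $s \in S$ every student in $Y$ has higher priority than every student in $Z$. Then every advantaged student $i \in Y$ whose DA school $\mathrm{DA}_i(P)$ is not fully segregated under $\mathrm{DA}(P)$ is unimprovable.
   Context: A school choice problem $P$ consists of a finite set $I$ of students, a finite set $S$ of schools, for each student $i$ a strict (linear) preference $\succ_i$ over $S$, and for each school $s$ a quota $q_s$ (a positive integer) and a strict (linear) priority order $\triangleright_s$ over $I$. The set $S$ may contain a null school $s_\emptyset$, which has unlimited capacity; students assigned to $s_\emptyset$ are called unassigned. If $S$ contains no null school, it is assumed that $\sum_{s\in S} q_s \ge |I|$, so that matchings exist. A matching $\mu$ is a map $I \to S$, $i \mapsto \mu_i$, with $|\mu^{-1}_s| \le q_s$ for every $s \in S$, where $\mu^{-1}_s = \{i \in I : \mu_i = s\}$. The rank of school $s$ for student $i$ is $\mathrm{rk}_i(s) = |\{s' \in S : s' \succ_i s\}| + 1$ (so the best school has rank 1). The student-proposing Deferred Acceptance (DA) mechanism: in round 1 every student applies to her most preferred school, and every school tentatively accepts the highest-priority applicants up to its quota and rejects the rest; in each later round every student rejected in the previous round applies to her next best school, and every school, among its new applicants and its previously accepted students, tentatively keeps the highest-priority ones up to its quota and rejects the rest; the procedure stops when there is a round without any rejection. The resulting matching is denoted $\mathrm{DA}(P)$, with $\mathrm{DA}_i(P)$ the school of student $i$.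 A mechanism $M$ associates to every school choice problem $P$ a matching $M(P)$; $M_i(P)$ is the school assigned to student $i$. A matching $\nu$ for $P$ is stable-dominating if $\mathrm{rk}_i(\nu_i) \le \mathrm{rk}_i(\mathrm{DA}_i(P))$ for every $i \in I$. A mechanism $M$ is stable-dominating if $M(P)$ is a stable-dominating matching for every school choice problem $P$. (DA itself is stable-dominating.) A student $i$ is unimprovable (in $P$) if he is assigned to the same school in every stable-dominating mechanism, i.e. $M_i(P) = \mathrm{DA}_i(P)$ for every stable-dominating mechanism $M$. A school $s$ is fully segregated under a matching $\mu$ if $\mu^{-1}_s \subseteq Y$ or $\mu^{-1}_s \subseteq Z$. *)

theory Defs
  imports Main "HOL-Library.Extended_Nat" "HOL-Library.While_Combinator"
begin

text \<open>
  \<open>(s, t) \<in> pref P i\<close> means that student \<open>i\<close> strictly prefers \<open>s\<close> to \<open>t\<close>, and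
  \<open>(i, j) \<in> prio P s\<close> means that \<open>i\<close> has strictly higher priority than \<open>j\<close> at \<open>s\<close>.
  The null school, if there is one, is the school with quota \<open>\<infinity>\<close>.
\<close>

record ('i, 's) problem =
  students :: "'i set"
  schools :: "'s set"
  pref :: "'i \<Rightarrow> 's rel"
  prio :: "'s \<Rightarrow> 'i rel"
  quota :: "'s \<Rightarrow> enat"

text \<open>
  The last condition holds trivially when there is a null school, since the sum is then
  infinite; otherwise it says that the total capacity suffices for all students.
\<close>

definition school_choice_problem :: "('i, 's) problem \<Rightarrow> bool" where
  "school_choice_problem P \<longleftrightarrow>
     finite (students P) \<and> finite (schools P) \<and>
     (\<forall>i\<in>students P. pref P i \<subseteq> schools P \<times> schools P \<and>
        strict_linear_order_on (schools P) (pref P i)) \<and>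
     (\<forall>s\<in>schools P. prio P s \<subseteq> students P \<times> students P \<and>
        strict_linear_order_on (students P) (prio P s)) \<and>
     (\<forall>s\<in>schools P. 0 < quota P s) \<and>
     (\<forall>s\<in>schools P. \<forall>t\<in>schools P. quota P s = \<infinity> \<and> quota P t = \<infinity> \<longrightarrow> s = t) \<and>
     enat (card (students P)) \<le> (\<Sum>s\<in>schools P. quota P s)"

text \<open>Assignments are total functions; only their values on \<open>students P\<close> are meaningful.\<close>

definition assigned :: "('i, 's) problem \<Rightarrow> ('i \<Rightarrow> 's) \<Rightarrow> 's \<Rightarrow> 'i set" where
  "assigned P \<mu> s = {i \<in> students P. \<mu> i = s}"

definition matching :: "('i, 's) problem \<Rightarrow> ('i \<Rightarrow> 's) \<Rightarrow> bool" where
  "matching P \<mu> \<longleftrightarrow>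
     (\<forall>i\<in>students P. \<mu> i \<in> schools P) \<and>
     (\<forall>s\<in>schools P. enat (card (assigned P \<mu> s)) \<le> quota P s)"

definition rk :: "('i, 's) problem \<Rightarrow> 'i \<Rightarrow> 's \<Rightarrow> nat" where
  "rk P i s = card {t \<in> schools P. (t, s) \<in> pref P i} + 1"

definition best :: "('i, 's) problem \<Rightarrow> 'i \<Rightarrow> 's set \<Rightarrow> 's" where
  "best P i A = (THE s. s \<in> A \<and> (\<forall>t \<in> A - {s}. (s, t) \<in> pref P i))"

text \<open>
  The state of the deferred acceptance procedure is the map \<open>a\<close> sending each student to the
  school to which she currently applies or at which she is tentatively held, so that
  \<open>assigned P a s\<close> consists of the new applicants and the previously accepted students of \<open>s\<close>.
  A student is among the highest-priority ones up to the quota iff the number of competitors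
  with higher priority is below the quota.
\<close>

definition rejected :: "('i, 's) problem \<Rightarrow> ('i \<Rightarrow> 's) \<Rightarrow> 'i set" where
  "rejected P a =
     {i \<in> students P. \<not> enat (card {j \<in> assigned P a (a i). (j, i) \<in> prio P (a i)}) < quota P (a i)}"

definition da_round :: "('i, 's) problem \<Rightarrow> ('i \<Rightarrow> 's) \<Rightarrow> 'i \<Rightarrow> 's" where
  "da_round P a = (\<lambda>i.
     if i \<in> rejected P a then best P i {t \<in> schools P. (a i, t) \<in> pref P i} else a i)"

definition DA :: "('i, 's) problem \<Rightarrow> 'i \<Rightarrow> 's" where
  "DA P = while (\<lambda>a. rejected P a \<noteq> {}) (da_round P) (\<lambda>i. best P i (schools P))"

definition stable_dominating :: "('i, 's) problem \<Rightarrow> ('i \<Rightarrow> 's) \<Rightarrow> bool" where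
  "stable_dominating P \<nu> \<longleftrightarrow>
     matching P \<nu> \<and> (\<forall>i\<in>students P. rk P i (\<nu> i) \<le> rk P i (DA P i))"

definition mechanism :: "(('i, 's) problem \<Rightarrow> 'i \<Rightarrow> 's) \<Rightarrow> bool" where
  "mechanism M \<longleftrightarrow> (\<forall>P. school_choice_problem P \<longrightarrow> matching P (M P))"

definition stable_dominating_mechanism :: "(('i, 's) problem \<Rightarrow> 'i \<Rightarrow> 's) \<Rightarrow> bool" where
  "stable_dominating_mechanism M \<longleftrightarrow>
     mechanism M \<and> (\<forall>P. school_choice_problem P \<longrightarrow> stable_dominating P (M P))"

definition unimprovable :: "('i, 's) problem \<Rightarrow> 'i \<Rightarrow> bool" where
  "unimprovable P i \<longleftrightarrow>
     (\<forall>M :: ('i, 's) problem \<Rightarrow> 'i \<Rightarrow> 's. stable_dominating_mechanism M \<longrightarrow> M P i = DA P i)"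

definition fully_segregated ::
    "('i, 's) problem \<Rightarrow> 'i set \<Rightarrow> 'i set \<Rightarrow> ('i \<Rightarrow> 's) \<Rightarrow> 's \<Rightarrow> bool" where
  "fully_segregated P Y Z \<mu> s \<longleftrightarrow> assigned P \<mu> s \<subseteq> Y \<or> assigned P \<mu> s \<subseteq> Z"

end

theory Submission imports Defs begin

text \<open>
  Write \<open>\<mu>\<close> for the Deferred Acceptance matching and let \<open>\<nu>\<close> dominate it. If a student moves into
  a school \<open>t\<close> under \<open>\<nu>\<close>, then stability of \<open>\<mu>\<close> says that \<open>t\<close> is full under \<open>\<mu>\<close> and that everybody
  held there has higher priority than the newcomer. So if the newcomer is advantaged, \<open>t\<close> holds only
  advantaged students under \<open>\<mu>\<close>. It follows that no school has more advantaged students under \<open>\<nu>\<close>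
  than under \<open>\<mu>\<close>; as both matchings place all of \<open>Y\<close>, the numbers agree at every school. A school
  that is mixed under \<open>\<mu>\<close> admits no new advantaged student, hence loses none either.
\<close>

section \<open>Ranks in finite linear orders\<close>

text \<open>Counting predecessors is injective on \<open>A\<close> and takes values below
  \<open>card A\<close>, hence is a bijection onto the positions \<open>0, ..., card A - 1\<close>;
  exactly \<open>q\<close> of these lie below \<open>q\<close>. Applied to the applicants of a
  school, this counts those that it keeps.\<close>

lemma card_below_rank:
  assumes "finite A" and lin: "trans r" "irrefl r" "total_on A r" and "q \<le> card A"
  shows "card {j \<in> A. card {k \<in> A. (k, j) \<in> r} < q} = q"
proof -
  define f where "f j = card {k \<in> A. (k, j) \<in> r}" for j
  have mono: "f i < f j" if "i \<in> A" "j \<in> A" "(i, j) \<in> r" for i j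
    unfolding f_def
  proof (rule psubset_card_mono)
    show "{k \<in> A. (k, i) \<in> r} \<subset> {k \<in> A. (k, j) \<in> r}"
      using that lin(1,2) by (auto simp: irrefl_def dest: transD)
  qed (use \<open>finite A\<close> in simp)
  have inj: "inj_on f A"
    using mono lin(3) by (fastforce simp: inj_on_def total_on_def)
  have "f j < card A" if "j \<in> A" for j
    unfolding f_def
  proof (rule psubset_card_mono)
    show "{k \<in> A. (k, j) \<in> r} \<subset> A"
      using that lin(2) by (auto simp: irrefl_def)
  qed fact
  then have sub: "f ` A \<subseteq> {..<card A}" by auto
  have "f ` A = {..<card A}"
    by (rule card_subset_eq) (use sub card_image[OF inj] in auto)
  moreover have "f ` {j \<in> A. f j < q} = f ` A \<inter> {..<q}" by auto
  ultimately have "f ` {j \<in> A. f j < q} = {..<q}"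
    using \<open>q \<le> card A\<close> by auto
  moreover have "inj_on f {j \<in> A. f j < q}"
    using inj by (rule inj_on_subset) auto
  ultimately show ?thesis
    unfolding f_def using card_image by fastforce
qed

lemma finite_linear_order_least:
  assumes "finite A" "A \<noteq> {}" and lin: "trans r" "irrefl r" "total_on A r"
  shows "\<exists>s. s \<in> A \<and> (\<forall>t \<in> A - {s}. (s, t) \<in> r)"
proof -
  have "1 \<le> card A"
    using assms(1,2) by (simp add: Suc_le_eq card_gt_0_iff)
  then have "card {j \<in> A. card {k \<in> A. (k, j) \<in> r} < 1} = 1"
    using card_below_rank assms by blast
  then obtain s where "s \<in> A" "{k \<in> A. (k, s) \<in> r} = {}"
    using assms(1) by (auto simp: card_1_singleton_iff)
  then show ?thesis
    using lin(3) by (auto simp: total_on_def)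
qed

lemma sum_card_fibers:
  assumes "finite W" "finite S" "f ` W \<subseteq> S"
  shows "(\<Sum>t\<in>S. card {i \<in> W. f i = t}) = card W"
  using sum.group[OF assms, of "\<lambda>_. 1 :: nat"] by simp

section \<open>Stability of Deferred Acceptance\<close>

lemma problem_finite:
  assumes "school_choice_problem P"
  shows "finite (students P)" "finite (schools P)" "finite (assigned P a s)"
  using assms by (auto simp: school_choice_problem_def assigned_def)

lemma pref_order:
  assumes "school_choice_problem P" "i \<in> students P"
  shows "pref P i \<subseteq> schools P \<times> schools P"
    and "trans (pref P i)" "irrefl (pref P i)" "total_on (schools P) (pref P i)"
  using assms by (auto simp: school_choice_problem_def strict_linear_order_on_def)

lemma pref_asym:
  assumes "school_choice_problem P" "i \<in> students P" "(s, t) \<in> pref P i"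
  shows "(t, s) \<notin> pref P i"
  using pref_order(2,3)[OF assms(1,2)] assms(3) by (auto simp: irrefl_def dest: transD)

lemma prio_order:
  assumes "school_choice_problem P" "s \<in> schools P"
  shows "trans (prio P s)" "irrefl (prio P s)" "total_on (students P) (prio P s)"
  using assms by (auto simp: school_choice_problem_def strict_linear_order_on_def)

lemma best_props:
  assumes P: "school_choice_problem P" and i: "i \<in> students P"
    and A: "A \<subseteq> schools P" "A \<noteq> {}"
  shows "best P i A \<in> A" and "\<And>t. t \<in> A \<Longrightarrow> t \<noteq> best P i A \<Longrightarrow> (best P i A, t) \<in> pref P i"
proof -
  let ?Q = "\<lambda>s. s \<in> A \<and> (\<forall>t \<in> A - {s}. (s, t) \<in> pref P i)"
  note ord = pref_order[OF P i]
  have "finite A" using A problem_finite[OF P] by (auto intro: finite_subset)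
  moreover have "total_on A (pref P i)" using A ord(4) by (auto simp: total_on_def)
  ultimately have "\<exists>s. ?Q s" using finite_linear_order_least A ord by blast
  moreover have "s = t" if "?Q s" "?Q t" for s t
    using that ord(2,3) by (metis Diff_iff irrefl_def singletonD transD)
  ultimately have "\<exists>!s. ?Q s" by blast
  then have "?Q (best P i A)" unfolding best_def by (rule theI')
  then show "best P i A \<in> A" "\<And>t. t \<in> A \<Longrightarrow> t \<noteq> best P i A \<Longrightarrow> (best P i A, t) \<in> pref P i"
    by auto
qed

text \<open>The second conjunct says that any school preferred to the current one would reject the
  student again. It counts all current applicants, including those about to be rejected, so it makes
  sense before the procedure has stopped.\<close>

definition da_invariant :: "('i, 's) problem \<Rightarrow> ('i \<Rightarrow> 's) \<Rightarrow> bool" where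
  "da_invariant P a \<longleftrightarrow> (\<forall>i\<in>students P. a i \<in> schools P \<and>
     (\<forall>t\<in>schools P. (t, a i) \<in> pref P i \<longrightarrow>
        quota P t \<le> enat (card {j \<in> assigned P a t. (j, i) \<in> prio P t})))"

lemma da_invariant_init:
  assumes P: "school_choice_problem P"
  shows "da_invariant P (\<lambda>i. best P i (schools P))"
  unfolding da_invariant_def
proof (intro ballI conjI impI)
  fix i assume i: "i \<in> students P"
  then have "card (students P) > 0"
    using problem_finite[OF P] by (auto simp: card_gt_0_iff)
  \<comment> \<open>Without schools the total capacity would be 0, too small for student
    \<open>i\<close>.\<close>
  then have ne: "schools P \<noteq> {}"
    using P by (auto simp: school_choice_problem_def zero_enat_def)
  note b = best_props[OF P i order_refl ne]
  show "best P i (schools P) \<in> schools P" by (rule b(1))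
  fix t assume "t \<in> schools P" "(t, best P i (schools P)) \<in> pref P i"
  then show "quota P t \<le> enat (card {j \<in> assigned P (\<lambda>i. best P i (schools P)) t. (j, i) \<in> prio P t})"
    using b(2)[of t] pref_asym[OF P i] pref_order(3)[OF P i] by (auto simp: irrefl_def)
qed

text \<open>Here the assumption on the total capacity enters: a student rejected by her last school would
  leave every school full.\<close>

lemma rejected_has_next:
  assumes P: "school_choice_problem P" and inv: "da_invariant P a" and i: "i \<in> rejected P a"
  shows "{t \<in> schools P. (a i, t) \<in> pref P i} \<noteq> {}"
proof
  assume emp: "{t \<in> schools P. (a i, t) \<in> pref P i} = {}"
  have iI: "i \<in> students P" using i by (simp add: rejected_def)
  have ai: "a i \<in> schools P" using inv iI by (simp add: da_invariant_def)
  note fin = problem_finite[OF P]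
  have above: "quota P t \<le> enat (card {j \<in> assigned P a t. (j, i) \<in> prio P t})"
    if t: "t \<in> schools P" for t
  proof (cases "t = a i")
    case True
    then show ?thesis using i by (simp add: rejected_def not_less)
  next
    case False
    then have "(t, a i) \<in> pref P i"
      using pref_order(4)[OF P iI] emp t ai by (auto simp: total_on_def)
    then show ?thesis using inv iI t by (simp add: da_invariant_def)
  qed
  have le: "card {j \<in> assigned P a t. (j, i) \<in> prio P t} \<le> card (assigned P a t)" for t
    by (intro card_mono fin) auto
  \<comment> \<open>Student \<open>i\<close> applies to \<open>a i\<close> without outranking
    herself; this one missing student makes the final count strict.\<close>
  have lt: "card {j \<in> assigned P a (a i). (j, i) \<in> prio P (a i)} < card (assigned P a (a i))"
  proof (rule psubset_card_mono)
    show "{j \<in> assigned P a (a i). (j, i) \<in> prio P (a i)} \<subset> assigned P a (a i)"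
      using iI prio_order(2)[OF P ai] by (auto simp: assigned_def irrefl_def)
  qed (rule fin)
  have "enat (card (students P)) \<le> (\<Sum>t\<in>schools P. quota P t)"
    using P by (simp add: school_choice_problem_def)
  also have "\<dots> \<le> (\<Sum>t\<in>schools P. enat (card {j \<in> assigned P a t. (j, i) \<in> prio P t}))"
    by (intro sum_mono above)
  also have "\<dots> = enat (\<Sum>t\<in>schools P. card {j \<in> assigned P a t. (j, i) \<in> prio P t})"
    by (simp flip: of_nat_eq_enat)
  finally have "card (students P) \<le> (\<Sum>t\<in>schools P. card {j \<in> assigned P a t. (j, i) \<in> prio P t})"
    by simp
  also have "\<dots> < (\<Sum>t\<in>schools P. card (assigned P a t))"
    using le lt ai fin(2) by (intro sum_strict_mono_ex1) auto
  also have "\<dots> = card (students P)"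
    unfolding assigned_def using inv fin by (intro sum_card_fibers) (auto simp: da_invariant_def)
  finally show False by simp
qed

text \<open>A school that is full with students above \<open>i\<close> keeps its top
  \<open>q\<close> applicants, \<open>q\<close> being the quota, and these are still above
  \<open>i\<close> after the round.\<close>

lemma da_invariant_round:
  assumes P: "school_choice_problem P" and inv: "da_invariant P a"
  shows "da_invariant P (da_round P a)"
  unfolding da_invariant_def
proof (intro ballI conjI impI)
  fix i assume i: "i \<in> students P"
  note ord = pref_order[OF P i]
  have ai: "a i \<in> schools P" using inv i by (simp add: da_invariant_def)
  let ?N = "{t \<in> schools P. (a i, t) \<in> pref P i}"
  have b: "best P i ?N \<in> ?N" "\<And>t. t \<in> ?N \<Longrightarrow> t \<noteq> best P i ?N \<Longrightarrow> (best P i ?N, t) \<in> pref P i"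
    if "i \<in> rejected P a"
    using best_props[OF P i, of ?N] rejected_has_next[OF P inv that] by auto
  show "da_round P a i \<in> schools P"
    using ai b(1) by (auto simp: da_round_def)
  fix t assume t: "t \<in> schools P" and better: "(t, da_round P a i) \<in> pref P i"
  have full: "quota P t \<le> enat (card {j \<in> assigned P a t. (j, i) \<in> prio P t})"
  proof (cases "(t, a i) \<in> pref P i")
    case True
    then show ?thesis using inv i t by (simp add: da_invariant_def)
  next
    case False
    then have rej: "i \<in> rejected P a" and tb: "(t, best P i ?N) \<in> pref P i"
      using better by (auto simp: da_round_def split: if_splits)
    \<comment> \<open>The new school is the best one below \<open>a i\<close>, so the better school
      \<open>t\<close> can only be \<open>a i\<close> itself, which has just rejected
      \<open>i\<close>.\<close>
    have "t \<notin> ?N"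
    proof
      assume "t \<in> ?N"
      then have "t = best P i ?N" using b(2)[OF rej] pref_asym[OF P i tb] by blast
      then show False using tb ord(3) by (simp add: irrefl_def)
    qed
    then have "t = a i" using False ord(4) t ai by (auto simp: total_on_def)
    then show ?thesis using rej by (simp add: rejected_def not_less)
  qed
  let ?U = "{j \<in> assigned P a t. (j, i) \<in> prio P t}"
  \<comment> \<open>The quota is bounded by a finite cardinality, so \<open>t\<close> is not the
    null school.\<close>
  obtain q where q: "quota P t = enat q" "q \<le> card ?U"
    using full by (cases "quota P t") auto
  note prio = prio_order[OF P t]
  have finU: "finite ?U" using problem_finite[OF P] by simp
  have totU: "total_on ?U (prio P t)"
    using prio(3) by (auto simp: total_on_def assigned_def)
  have "q = card {j \<in> ?U. card {k \<in> ?U. (k, j) \<in> prio P t} < q}"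
    using card_below_rank[OF finU prio(1,2) totU q(2)] by simp
  also have "\<dots> \<le> card {j \<in> assigned P (da_round P a) t. (j, i) \<in> prio P t}"
  proof (rule card_mono)
    show "{j \<in> ?U. card {k \<in> ?U. (k, j) \<in> prio P t} < q}
        \<subseteq> {j \<in> assigned P (da_round P a) t. (j, i) \<in> prio P t}"
    proof
      fix j assume j: "j \<in> {j \<in> ?U. card {k \<in> ?U. (k, j) \<in> prio P t} < q}"
      \<comment> \<open>Whoever outranks \<open>j\<close> also outranks \<open>i\<close> and so lies
        in \<open>?U\<close>: the position of \<open>j\<close> in \<open>?U\<close> is the position
        among all applicants.\<close>
      then have "{k \<in> assigned P a t. (k, j) \<in> prio P t} = {k \<in> ?U. (k, j) \<in> prio P t}"
        using prio(1) by (auto dest: transD)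
      then have "j \<notin> rejected P a"
        using j q(1) by (auto simp: rejected_def assigned_def)
      then show "j \<in> {j \<in> assigned P (da_round P a) t. (j, i) \<in> prio P t}"
        using j by (auto simp: assigned_def da_round_def)
    qed
  qed (use problem_finite[OF P] in simp)
  finally show "quota P t \<le> enat (card {j \<in> assigned P (da_round P a) t. (j, i) \<in> prio P t})"
    using q(1) by simp
qed

text \<open>The termination measure is the total number of schools left below the current
  applications. A rejected student moves strictly down her list, the others stay.\<close>

lemma da_round_decreases:
  assumes P: "school_choice_problem P" and inv: "da_invariant P a" and rej: "rejected P a \<noteq> {}"
  shows "(\<Sum>i\<in>students P. card {t \<in> schools P. (da_round P a i, t) \<in> pref P i})
       < (\<Sum>i\<in>students P. card {t \<in> schools P. (a i, t) \<in> pref P i})"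
proof (rule sum_strict_mono_ex1)
  have lt: "card {t \<in> schools P. (da_round P a i, t) \<in> pref P i}
      < card {t \<in> schools P. (a i, t) \<in> pref P i}" if "i \<in> rejected P a" for i
  proof (rule psubset_card_mono)
    have i: "i \<in> students P" using that by (simp add: rejected_def)
    have "da_round P a i \<in> {t \<in> schools P. (a i, t) \<in> pref P i}"
      using best_props(1)[OF P i _ rejected_has_next[OF P inv that]] that
      by (simp add: da_round_def)
    then show "{t \<in> schools P. (da_round P a i, t) \<in> pref P i}
        \<subset> {t \<in> schools P. (a i, t) \<in> pref P i}"
      using pref_order(2,3)[OF P i] by (auto simp: irrefl_def dest: transD)
  qed (use problem_finite[OF P] in simp)
  show "\<forall>i\<in>students P. card {t \<in> schools P. (da_round P a i, t) \<in> pref P i}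
      \<le> card {t \<in> schools P. (a i, t) \<in> pref P i}"
    using lt by (auto simp: da_round_def intro: less_imp_le)
  show "\<exists>i\<in>students P. card {t \<in> schools P. (da_round P a i, t) \<in> pref P i}
      < card {t \<in> schools P. (a i, t) \<in> pref P i}"
    using lt rej by (auto simp: rejected_def)
qed (rule problem_finite[OF P])

text \<open>Termination and the invariant are proved together, since the measure is shown to drop
  only in states satisfying the invariant, where a rejected student has a next school.\<close>

lemma DA_final:
  assumes P: "school_choice_problem P"
  shows "da_invariant P (DA P)" "rejected P (DA P) = {}"
proof -
  have "da_invariant P (DA P) \<and> rejected P (DA P) = {}"
    unfolding DA_def
  proof (rule while_rule[where P = "da_invariant P" and
        r = "measure (\<lambda>a. \<Sum>i\<in>students P. card {t \<in> schools P. (a i, t) \<in> pref P i})"])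
    show "da_invariant P (\<lambda>i. best P i (schools P))" by (rule da_invariant_init[OF P])
  qed (auto intro: da_invariant_round[OF P] da_round_decreases[OF P])
  then show "da_invariant P (DA P)" "rejected P (DA P) = {}" by auto
qed

lemma DA_in_schools:
  assumes "school_choice_problem P" "i \<in> students P"
  shows "DA P i \<in> schools P"
  using DA_final(1)[OF assms(1)] assms(2) by (simp add: da_invariant_def)

lemma DA_stable:
  assumes P: "school_choice_problem P" and i: "i \<in> students P"
    and better: "(t, DA P i) \<in> pref P i"
  shows "quota P t \<le> enat (card (assigned P (DA P) t))"
    and "\<And>j. j \<in> assigned P (DA P) t \<Longrightarrow> (j, i) \<in> prio P t"
proof -
  let ?A = "assigned P (DA P) t"
  have t: "t \<in> schools P" using pref_order(1)[OF P i] better by auto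
  note prio = prio_order[OF P t]
  have full: "quota P t \<le> enat (card {j \<in> ?A. (j, i) \<in> prio P t})"
    using DA_final(1)[OF P] i t better by (simp add: da_invariant_def)
  also have "\<dots> \<le> enat (card ?A)"
    using problem_finite[OF P] by (auto intro: card_mono)
  finally show "quota P t \<le> enat (card ?A)" .
  fix j assume j: "j \<in> ?A"
  show "(j, i) \<in> prio P t"
  proof (rule ccontr)
    assume "(j, i) \<notin> prio P t"
    then have "i = j \<or> (i, j) \<in> prio P t"
      using prio(3) i j by (auto simp: total_on_def assigned_def)
    \<comment> \<open>If \<open>j\<close> does not outrank \<open>i\<close>, the quota-many students
      above \<open>i\<close> are also above \<open>j\<close>, so \<open>j\<close> would be rejected
      in the final state.\<close>
    then have "{k \<in> ?A. (k, i) \<in> prio P t} \<subseteq> {k \<in> ?A. (k, j) \<in> prio P t}"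
      using prio(1) by (auto dest: transD)
    then have "card {k \<in> ?A. (k, i) \<in> prio P t} \<le> card {k \<in> ?A. (k, j) \<in> prio P t}"
      using problem_finite[OF P] by (auto intro: card_mono)
    then have "quota P t \<le> enat (card {k \<in> ?A. (k, j) \<in> prio P t})"
      using full by (meson enat_ord_simps(1) order_trans)
    then have "j \<in> rejected P (DA P)"
      using j by (auto simp: rejected_def assigned_def)
    then show False using DA_final(2)[OF P] by simp
  qed
qed

section \<open>Matchings that dominate Deferred Acceptance\<close>

lemma rk_le_imp_pref:
  assumes P: "school_choice_problem P" and i: "i \<in> students P"
    and st: "s \<in> schools P" "t \<in> schools P" and "rk P i s \<le> rk P i t" "s \<noteq> t"
  shows "(s, t) \<in> pref P i"
proof (rule ccontr)
  note ord = pref_order[OF P i]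
  assume "(s, t) \<notin> pref P i"
  then have ts: "(t, s) \<in> pref P i" using ord(4) st \<open>s \<noteq> t\<close> by (auto simp: total_on_def)
  then have "{u \<in> schools P. (u, t) \<in> pref P i} \<subset> {u \<in> schools P. (u, s) \<in> pref P i}"
    using ord(2,3) st by (auto simp: irrefl_def dest: transD)
  then have "rk P i t < rk P i s"
    using problem_finite[OF P] by (auto simp: rk_def intro: psubset_card_mono)
  then show False using assms(5) by simp
qed

lemma stable_dominating_newcomer:
  assumes P: "school_choice_problem P" and dom: "stable_dominating P \<nu>"
    and i: "i \<in> assigned P \<nu> t" "i \<notin> assigned P (DA P) t"
  shows "quota P t \<le> enat (card (assigned P (DA P) t))"
    and "\<And>j. j \<in> assigned P (DA P) t \<Longrightarrow> (j, i) \<in> prio P t"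
proof -
  have iI: "i \<in> students P" and ne: "\<nu> i \<noteq> DA P i" and "\<nu> i = t"
    using i by (auto simp: assigned_def)
  moreover have "(\<nu> i, DA P i) \<in> pref P i"
    using dom iI ne DA_in_schools[OF P iI]
    by (intro rk_le_imp_pref[OF P iI]) (auto simp: stable_dominating_def matching_def)
  ultimately show "quota P t \<le> enat (card (assigned P (DA P) t))"
    "\<And>j. j \<in> assigned P (DA P) t \<Longrightarrow> (j, i) \<in> prio P t"
    using DA_stable[OF P iI] by auto
qed

text \<open>Either \<open>t\<close> has no newcomer under \<nu>, or a newcomer shows that
  \<open>t\<close> was full under DA, and \<nu> respects the quota.\<close>

lemma stable_dominating_card_le:
  assumes P: "school_choice_problem P" and dom: "stable_dominating P \<nu>" and t: "t \<in> schools P"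
  shows "card (assigned P \<nu> t) \<le> card (assigned P (DA P) t)"
proof (cases "assigned P \<nu> t \<subseteq> assigned P (DA P) t")
  case True
  then show ?thesis using problem_finite[OF P] by (intro card_mono) auto
next
  case False
  then have "quota P t \<le> enat (card (assigned P (DA P) t))"
    using stable_dominating_newcomer(1)[OF P dom] by blast
  moreover have "enat (card (assigned P \<nu> t)) \<le> quota P t"
    using dom t by (simp add: stable_dominating_def matching_def)
  ultimately show ?thesis by (meson enat_ord_simps(1) order_trans)
qed

lemma stable_dominating_eq_DA:
  assumes P: "school_choice_problem P" and YZ: "students P = Y \<union> Z" "Y \<inter> Z = {}"
    and prio: "\<forall>s\<in>schools P. \<forall>y\<in>Y. \<forall>z\<in>Z. (y, z) \<in> prio P s"
    and dom: "stable_dominating P \<nu>"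
    and i: "i \<in> Y" and mixed: "\<not> fully_segregated P Y Z (DA P) (DA P i)"
  shows "\<nu> i = DA P i"
proof -
  note fin = problem_finite[OF P]
  have finY: "finite Y" using fin(1) YZ by auto
  have fibers: "{j \<in> Y. f j = t} = Y \<inter> assigned P f t" for f t
    using YZ by (auto simp: assigned_def)
  \<comment> \<open>A marginalized \<open>j\<close> held at \<open>t\<close> would rank both below
    the advantaged newcomer \<open>y\<close>, by assumption, and above, by stability.\<close>
  have no_Z: "j \<in> Y"
    if t: "t \<in> schools P" and new: "y \<in> Y" "y \<in> assigned P \<nu> t" "y \<notin> assigned P (DA P) t"
      and j: "j \<in> assigned P (DA P) t" for t y j
  proof (rule ccontr)
    assume "j \<notin> Y"
    then have "(y, j) \<in> prio P t" using prio t new(1) j YZ by (auto simp: assigned_def)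
    moreover have "(j, y) \<in> prio P t"
      using stable_dominating_newcomer(2)[OF P dom new(2,3) j] .
    ultimately show False using prio_order(1,2)[OF P t] by (meson irrefl_def transD)
  qed
  have le: "card {j \<in> Y. \<nu> j = t} \<le> card {j \<in> Y. DA P j = t}" if t: "t \<in> schools P" for t
  proof (cases "Y \<inter> assigned P \<nu> t \<subseteq> assigned P (DA P) t")
    case True
    then show ?thesis unfolding fibers using finY by (intro card_mono) auto
  next
    case False
    then have "assigned P (DA P) t \<subseteq> Y" using no_Z[OF t] by blast
    then have "Y \<inter> assigned P (DA P) t = assigned P (DA P) t" by blast
    moreover have "card (Y \<inter> assigned P \<nu> t) \<le> card (assigned P \<nu> t)"
      using fin by (intro card_mono) auto
    ultimately show ?thesis
      unfolding fibers using stable_dominating_card_le[OF P dom t] by simp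
  qed
  let ?s = "DA P i"
  have iI: "i \<in> students P" using i YZ by simp
  have s: "?s \<in> schools P" using DA_in_schools[OF P iI] .
  have "(\<Sum>t\<in>schools P. card {j \<in> Y. \<nu> j = t}) = card Y"
    using dom YZ fin finY
    by (intro sum_card_fibers) (auto simp: stable_dominating_def matching_def)
  moreover have "(\<Sum>t\<in>schools P. card {j \<in> Y. DA P j = t}) = card Y"
    using DA_in_schools[OF P] YZ fin finY by (intro sum_card_fibers) auto
  ultimately have "(\<Sum>t\<in>schools P. card {j \<in> Y. \<nu> j = t}) = (\<Sum>t\<in>schools P. card {j \<in> Y. DA P j = t})"
    by (rule trans[OF _ sym])
  \<comment> \<open>Equal sums with termwise inequality \<open>le\<close> force equality in every
    term.\<close>
  then have "card {j \<in> Y. \<nu> j = ?s} = card {j \<in> Y. DA P j = ?s}"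
    by (rule sum_mono_inv[OF _ le s fin(2)])
  \<comment> \<open>Since \<open>?s\<close> is mixed, it holds a student outside \<open>Y\<close>,
    so \<open>no_Z\<close> rules out any newcomer from \<open>Y\<close>.\<close>
  moreover have "{j \<in> Y. \<nu> j = ?s} \<subseteq> {j \<in> Y. DA P j = ?s}"
    unfolding fibers using no_Z[OF s] mixed by (auto simp: fully_segregated_def)
  ultimately have "{j \<in> Y. \<nu> j = ?s} = {j \<in> Y. DA P j = ?s}"
    using finY by (intro card_subset_eq) auto
  then show ?thesis using i by blast
qed

theorem proposition4:
  fixes P :: "('i, 's) problem" and Y Z :: "'i set"
  assumes "school_choice_problem P"
    and "students P = Y \<union> Z" and "Y \<inter> Z = {}" and "Y \<noteq> {}" and "Z \<noteq> {}"
    and "\<forall>s\<in>schools P. \<forall>y\<in>Y. \<forall>z\<in>Z. (y, z) \<in> prio P s"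
  shows "\<forall>i\<in>Y. \<not> fully_segregated P Y Z (DA P) (DA P i) \<longrightarrow> unimprovable P i"
  unfolding unimprovable_def stable_dominating_mechanism_def
  using stable_dominating_eq_DA[OF assms(1-3,6)] assms(1) by blast

end
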